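(* Let $k\ge 2$ and let $G_1$ and $G_2$ be two $H$-consistent graphs. Then $H(G_1,G_2)$ is $k$-crossing free if and only if $$\mathsf{TS}_k(H(G_1,G_2))=\mathsf{TS}_k(G_1)\cup\mathsf{TS}_k(G_2).$$
   Context: Graphs are finite, simple, undirected and vertex-labelled (vertices are identified by their labels). For a graph $G$ and an integer $k\ge 2$, $\mathsf{TS}_k(G)$ is the graph whose nodes are all size-$k$ independent sets of $G$, two nodes $I,J$ being adjacent if there are vertices $u,v$ of $G$ with $I\setminus J=\{u\}$, $J\setminus I=\{v\}$ and $uv\in E(G)$. The union $\cup$ of two labelled graphs has as vertex set (edge set) the union of the vertex sets (edge sets). Graphs $G_1,G_2$ are $H$-consistent if the (possibly empty) set $V(G_1)\cap V(G_2)$ induces the same (possibly empty) subgraph $H$ in both $G_1$ and $G_2$. The $H$-join of $H$-consistent graphs $G_1,G_2$ is the graph $H(G_1,G_2)$ with vertex set $V(G_1)\cup V(G_2)$ and edge set consisting of $E(G_1)\cup E(G_2)$ together with all edges $vw$ with $v\in V(G_1)\setminus V(H)$ and $w\in V(G_2)\setminus V(H)$. $H(G_1,G_2)$ is $k$-crossing free if there are no $k$-element independent sets $S_1$ of $G_1$ and $S_2$ of $G_2$ with $|S_1\cap V(H)|=|S_2\cap V(H)|=|S_1\cap S_2|=k-1$. *)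

theory Defs
  imports "Graph_Theory.Graph_Theory"
begin

text \<open>
  A finite simple undirected graph is a \<open>pair_graph\<close>: the arc relation is symmetric and
  irreflexive, and an edge \<open>uv\<close> is the pair of arcs \<open>(u, v)\<close>, \<open>(v, u)\<close>.
  Vertices are their own labels, so equality of labelled graphs is equality of records.
\<close>

definition independent_set :: "'a pair_pre_digraph \<Rightarrow> 'a set \<Rightarrow> bool" where
  "independent_set G S \<longleftrightarrow> S \<subseteq> pverts G \<and> (\<forall>u\<in>S. \<forall>v\<in>S. (u, v) \<notin> parcs G)"

definition independent_sets :: "nat \<Rightarrow> 'a pair_pre_digraph \<Rightarrow> 'a set set" where
  "independent_sets k G = {S. independent_set G S \<and> card S = k}"

definition TS :: "nat \<Rightarrow> 'a pair_pre_digraph \<Rightarrow> 'a set pair_pre_digraph" where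
  "TS k G = \<lparr> pverts = independent_sets k G,
     parcs = {(I, J). I \<in> independent_sets k G \<and> J \<in> independent_sets k G \<and>
                (\<exists>u v. I - J = {u} \<and> J - I = {v} \<and> (u, v) \<in> parcs G)} \<rparr>"

definition consistent ::
  "'a pair_pre_digraph \<Rightarrow> 'a pair_pre_digraph \<Rightarrow> 'a pair_pre_digraph \<Rightarrow> bool" where
  "consistent H G1 G2 \<longleftrightarrow> pverts H = pverts G1 \<inter> pverts G2 \<and>
     induced_subgraph (with_proj H) (with_proj G1) \<and>
     induced_subgraph (with_proj H) (with_proj G2)"

text \<open>The two products are the two orientations of each added edge.\<close>

definition join ::
  "'a pair_pre_digraph \<Rightarrow> 'a pair_pre_digraph \<Rightarrow> 'a pair_pre_digraph \<Rightarrow> 'a pair_pre_digraph" where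
  "join H G1 G2 = \<lparr> pverts = pverts G1 \<union> pverts G2,
     parcs = parcs G1 \<union> parcs G2
       \<union> (pverts G1 - pverts H) \<times> (pverts G2 - pverts H)
       \<union> (pverts G2 - pverts H) \<times> (pverts G1 - pverts H) \<rparr>"

text \<open>A property of the triple \<open>H\<close>, \<open>G1\<close>, \<open>G2\<close>, not of the graph \<open>join H G1 G2\<close> alone.\<close>

definition crossing_free ::
  "nat \<Rightarrow> 'a pair_pre_digraph \<Rightarrow> 'a pair_pre_digraph \<Rightarrow> 'a pair_pre_digraph \<Rightarrow> bool" where
  "crossing_free k H G1 G2 \<longleftrightarrow>
     \<not> (\<exists>S1 \<in> independent_sets k G1. \<exists>S2 \<in> independent_sets k G2.
           card (S1 \<inter> pverts H) = k - 1 \<and> card (S2 \<inter> pverts H) = k - 1 \<and>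
           card (S1 \<inter> S2) = k - 1)"

text \<open>
  The library's \<open>union\<close> of graphs lives on the general digraph type; the embedding
  \<open>with_proj\<close> of pair digraphs into it loses nothing.
\<close>

lemma with_proj_eq_iff: "with_proj G = with_proj G' \<longleftrightarrow> G = G'"
  by (cases G; cases G') (auto simp: with_proj_def)

lemma with_proj_eq_union_iff:
  "with_proj G = Digraph_Component.union (with_proj G1) (with_proj G2) \<longleftrightarrow>
     pverts G = pverts G1 \<union> pverts G2 \<and> parcs G = parcs G1 \<union> parcs G2"
  by (auto simp: with_proj_def Digraph_Component.union_def)

lemma pair_graph_join:
  assumes "pair_graph G1" "pair_graph G2" "consistent H G1 G2"
  shows "pair_graph (join H G1 G2)"
proof -
  interpret G1: pair_graph G1 by fact
  interpret G2: pair_graph G2 by fact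
  have H: "pverts H = pverts G1 \<inter> pverts G2"
    using assms(3) by (simp add: consistent_def)
  have sub: "parcs (join H G1 G2) \<subseteq> pverts (join H G1 G2) \<times> pverts (join H G1 G2)"
    unfolding join_def using G1.wellformed' G2.wellformed' by fastforce
  have fin: "finite (pverts (join H G1 G2))"
    by (simp add: join_def G1.pair_finite_verts G2.pair_finite_verts)
  have sym: "(v, u) \<in> parcs (join H G1 G2)" if "(u, v) \<in> parcs (join H G1 G2)" for u v
    using that G1.arcs_symmetric G2.arcs_symmetric by (force simp: join_def)
  have irr: "u \<noteq> v" if "(u, v) \<in> parcs (join H G1 G2)" for u v
    using that G1.no_loops' G2.no_loops' H by (auto simp: join_def)
  show ?thesis
  proof
    show "finite (parcs (join H G1 G2))"
      using finite_subset[OF sub] fin by blast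
    show "symmetric (with_proj (join H G1 G2))"
      using sym by (auto simp: symmetric_def intro: symI)
  qed (use sub fin irr in auto)
qed

lemma pair_graph_TS:
  assumes "pair_graph G"
  shows "pair_graph (TS k G)"
proof -
  interpret pair_graph G by fact
  have "independent_sets k G \<subseteq> Pow (pverts G)"
    by (auto simp: independent_sets_def independent_set_def)
  then have fin: "finite (independent_sets k G)"
    using pair_finite_verts finite_subset by blast
  have sub: "parcs (TS k G) \<subseteq> pverts (TS k G) \<times> pverts (TS k G)"
    by (auto simp: TS_def)
  have finV: "finite (pverts (TS k G))"
    using fin by (simp add: TS_def)
  have irr: "I \<noteq> J" if "(I, J) \<in> parcs (TS k G)" for I J
    using that by (auto simp: TS_def)
  show ?thesis
  proof
    show "finite (parcs (TS k G))"
      using finite_subset[OF sub] finV by blast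
    show "symmetric (with_proj (TS k G))"
      unfolding symmetric_def with_proj_simps
      by (rule symI) (auto simp: TS_def dest: arcs_symmetric)
  qed (use sub finV irr in auto)
qed

end

theory Submission
  imports Defs
begin

text \<open>
  Every vertex of \<open>V(G1) - V(H)\<close> is joined to every vertex of \<open>V(G2) - V(H)\<close>, so an independent
  set of the join lies within one side, and the nodes of the two sides of the equation always agree.
  An arc \<open>(I, J)\<close> of the left-hand side is missing on the right only if neither \<open>V(G1)\<close> nor \<open>V(G2)\<close>
  contains both \<open>I\<close> and \<open>J\<close>; then \<open>I \<inter> J\<close>, of size \<open>k - 1\<close>, is the part of \<open>I\<close> and the part of \<open>J\<close>
  in \<open>V(H)\<close>, which is a crossing. Conversely, the two sets of a crossing differ by sliding along
  an added edge.
\<close>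

lemma consistent_commute: "consistent H G1 G2 \<longleftrightarrow> consistent H G2 G1"
  by (auto simp: consistent_def)

lemma join_commute: "join H G1 G2 = join H G2 G1"
  by (auto simp: join_def)

lemma parcs_consistent_iff:
  assumes "consistent H G1 G2" "u \<in> pverts H" "v \<in> pverts H"
  shows "(u, v) \<in> parcs G1 \<longleftrightarrow> (u, v) \<in> parcs G2"
proof -
  have "parcs H = {e \<in> parcs G1. fst e \<in> pverts H \<and> snd e \<in> pverts H}"
    "parcs H = {e \<in> parcs G2. fst e \<in> pverts H \<and> snd e \<in> pverts H}"
    using assms(1) unfolding consistent_def induced_subgraph_def with_proj_simps by blast+
  then show ?thesis
    using assms(2,3) by (metis (no_types, lifting) fst_conv mem_Collect_eq snd_conv)
qed

text \<open>An added edge has an end in \<open>pverts G2 - pverts H\<close>, hence outside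
  \<open>pverts G1\<close>. An arc of \<open>G2\<close> between vertices of \<open>G1\<close> has
  both ends in \<open>pverts H\<close>, where the two graphs agree.\<close>

lemma parcs_join_iff_left:
  assumes "pair_graph G2" "consistent H G1 G2" "u \<in> pverts G1" "v \<in> pverts G1"
  shows "(u, v) \<in> parcs (join H G1 G2) \<longleftrightarrow> (u, v) \<in> parcs G1"
proof -
  interpret G2: pair_graph G2 by fact
  have H: "pverts H = pverts G1 \<inter> pverts G2"
    using assms(2) by (simp add: consistent_def)
  have "(u, v) \<in> parcs G1" if "(u, v) \<in> parcs G2"
    using that G2.wellformed'[OF that] parcs_consistent_iff[OF assms(2), of u v] assms(3,4) H
    by auto
  then show ?thesis
    using assms(3,4) H by (auto simp: join_def)
qed

lemma independent_set_join_iff_left: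
  assumes "pair_graph G2" "consistent H G1 G2" "S \<subseteq> pverts G1"
  shows "independent_set (join H G1 G2) S \<longleftrightarrow> independent_set G1 S"
proof -
  have "S \<subseteq> pverts (join H G1 G2)"
    using assms(3) by (auto simp: join_def)
  then show ?thesis
    unfolding independent_set_def
    using parcs_join_iff_left[OF assms(1,2)] assms(3) by (simp add: subset_iff)
qed

lemma independent_set_join_side:
  assumes "consistent H G1 G2" "independent_set (join H G1 G2) S"
  shows "S \<subseteq> pverts G1 \<or> S \<subseteq> pverts G2"
proof (rule ccontr)
  assume "\<not> ?thesis"
  then obtain u v where "u \<in> S" "v \<in> S" "u \<notin> pverts G1" "v \<notin> pverts G2"
    by blast
  moreover have "S \<subseteq> pverts G1 \<union> pverts G2"
    using assms(2) by (simp add: independent_set_def join_def)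
  \<comment> \<open>Neither vertex is in \<open>pverts H\<close>, and they are on opposite sides, so
    the join adds an edge between them.\<close>
  ultimately have "(u, v) \<in> parcs (join H G1 G2)"
    using assms(1) by (auto simp: join_def consistent_def)
  then show False
    using assms(2) \<open>u \<in> S\<close> \<open>v \<in> S\<close> by (simp add: independent_set_def)
qed

lemma independent_sets_subset: "S \<in> independent_sets k G \<Longrightarrow> S \<subseteq> pverts G"
  by (simp add: independent_sets_def independent_set_def)

lemma independent_sets_join_iff_left:
  assumes "pair_graph G2" "consistent H G1 G2"
  shows "S \<in> independent_sets k G1 \<longleftrightarrow>
    S \<in> independent_sets k (join H G1 G2) \<and> S \<subseteq> pverts G1"
  using independent_set_join_iff_left[OF assms, of S] independent_sets_subset[of S k G1]
  by (auto simp: independent_sets_def)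

text \<open>The token moves between a vertex of \<open>I\<close> and a vertex of \<open>J\<close>.
  If both sets lie in \<open>pverts G1\<close>, the join has exactly the arcs of \<open>G1\<close>
  between these vertices.\<close>

lemma parcs_TS_iff_left:
  assumes "pair_graph G2" "consistent H G1 G2"
  shows "(I, J) \<in> parcs (TS k G1) \<longleftrightarrow>
    (I, J) \<in> parcs (TS k (join H G1 G2)) \<and> I \<subseteq> pverts G1 \<and> J \<subseteq> pverts G1"
proof (cases "I \<subseteq> pverts G1 \<and> J \<subseteq> pverts G1")
  case True
  have "(u, v) \<in> parcs (join H G1 G2) \<longleftrightarrow> (u, v) \<in> parcs G1"
    if "I - J = {u}" "J - I = {v}" for u v
    using that True by (intro parcs_join_iff_left[OF assms]) auto
  then show ?thesis
    using True independent_sets_join_iff_left[OF assms] by (auto simp: TS_def)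
next
  case False
  then show ?thesis
    by (auto simp: TS_def dest: independent_sets_subset)
qed

text \<open>Consistency and the join are symmetric in \<open>G1\<close> and \<open>G2\<close>, so
  the two graphs may exchange roles.\<close>

lemma parcs_TS_iff_right:
  assumes "pair_graph G1" "consistent H G1 G2"
  shows "(I, J) \<in> parcs (TS k G2) \<longleftrightarrow>
    (I, J) \<in> parcs (TS k (join H G1 G2)) \<and> I \<subseteq> pverts G2 \<and> J \<subseteq> pverts G2"
  using parcs_TS_iff_left[of G1 H G2 I J k] assms
  by (simp add: consistent_commute[of H G2 G1] join_commute[of H G2 G1])

lemma pverts_TS_join:
  assumes "pair_graph G1" "pair_graph G2" "consistent H G1 G2"
  shows "pverts (TS k (join H G1 G2)) = pverts (TS k G1) \<union> pverts (TS k G2)"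
proof -
  have "S \<subseteq> pverts G1 \<or> S \<subseteq> pverts G2" if "S \<in> independent_sets k (join H G1 G2)" for S
    using that independent_set_join_side[OF assms(3)] by (simp add: independent_sets_def)
  moreover have "S \<in> independent_sets k G2 \<longleftrightarrow>
      S \<in> independent_sets k (join H G1 G2) \<and> S \<subseteq> pverts G2" for S
    using independent_sets_join_iff_left[of G1 H G2 S k] assms
    by (simp add: consistent_commute[of H G2 G1] join_commute[of H G2 G1])
  ultimately have "S \<in> independent_sets k (join H G1 G2) \<longleftrightarrow>
      S \<in> independent_sets k G1 \<or> S \<in> independent_sets k G2" for S
    using independent_sets_join_iff_left[OF assms(2,3), of S k] by metis
  then show ?thesis
    by (simp add: TS_def set_eq_iff)
qed

text \<open>The token moves along one of the edges added by the join.\<close>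

lemma crossing_TS_join:
  assumes "pair_graph G1" "pair_graph G2" "consistent H G1 G2" "k \<ge> 1"
    and "I \<in> independent_sets k G1" "J \<in> independent_sets k G2"
    and "card (I \<inter> pverts H) = k - 1" "card (J \<inter> pverts H) = k - 1" "card (I \<inter> J) = k - 1"
  shows "(I, J) \<in> parcs (TS k (join H G1 G2)) \<and> \<not> J \<subseteq> pverts G1 \<and> \<not> I \<subseteq> pverts G2"
proof -
  have H: "pverts H = pverts G1 \<inter> pverts G2"
    using assms(3) by (simp add: consistent_def)
  have sub: "I \<subseteq> pverts G1" "J \<subseteq> pverts G2"
    using assms(5,6) by (auto dest: independent_sets_subset)
  have card: "card I = k" "card J = k"
    using assms(5,6) by (auto simp: independent_sets_def)
  \<comment> \<open>A positive cardinality rules out infinite sets, whose \<open>card\<close> is 0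
    by default.\<close>
  with assms(4) have fin: "finite I" "finite J"
    by (auto intro: card_ge_0_finite)
  have "I \<inter> J \<subseteq> I \<inter> pverts H" "I \<inter> J \<subseteq> J \<inter> pverts H"
    using sub H by blast+
  \<comment> \<open>All three intersections have \<open>k - 1\<close> elements, so the inclusions
    are equalities.\<close>
  then have eq: "I \<inter> J = I \<inter> pverts H" "I \<inter> J = J \<inter> pverts H"
    using fin assms(7-9) by (simp_all add: card_subset_eq)
  have "card (I - J) = 1" "card (J - I) = 1"
    using card_Diff_subset_Int[of I J] card_Diff_subset_Int[of J I] fin card assms(4,9)
    by (auto simp: Int_commute)
  then obtain u v where uv: "I - J = {u}" "J - I = {v}"
    by (auto simp: card_1_singleton_iff)
  then have u: "u \<in> I" "u \<in> pverts G1 - pverts H" and v: "v \<in> J" "v \<in> pverts G2 - pverts H"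
    using sub eq by blast+
  then have "(u, v) \<in> parcs (join H G1 G2)"
    by (simp add: join_def)
  moreover have "I \<in> pverts (TS k (join H G1 G2))" "J \<in> pverts (TS k (join H G1 G2))"
    using assms(5,6) pverts_TS_join[OF assms(1-3)] by (auto simp: TS_def)
  ultimately have "(I, J) \<in> parcs (TS k (join H G1 G2))"
    using uv by (simp add: TS_def)
  then show ?thesis
    using u v H by blast
qed

lemma TS_join_crossing:
  assumes "pair_graph G1" "pair_graph G2" "consistent H G1 G2"
    and "(I, J) \<in> parcs (TS k (join H G1 G2))"
    and "I \<subseteq> pverts G1" "\<not> I \<subseteq> pverts G2" "J \<subseteq> pverts G2" "\<not> J \<subseteq> pverts G1"
  shows "\<not> crossing_free k H G1 G2"
proof -
  interpret G1: pair_graph G1 by fact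
  have H: "pverts H = pverts G1 \<inter> pverts G2"
    using assms(3) by (simp add: consistent_def)
  obtain u v where uv: "I - J = {u}" "J - I = {v}"
    and IJ: "I \<in> pverts (TS k (join H G1 G2))" "J \<in> pverts (TS k (join H G1 G2))"
    using assms(4) by (auto simp: TS_def)
  have mem: "I \<in> independent_sets k G1" "J \<in> independent_sets k G2"
    using IJ pverts_TS_join[OF assms(1-3)] assms(6,8)
    by (auto simp: TS_def dest: independent_sets_subset)
  have "I \<subseteq> insert u J" "J \<subseteq> insert v I"
    using uv by blast+
  \<comment> \<open>Some vertex of \<open>I\<close> is outside \<open>pverts G2\<close>; as
    \<open>J\<close> lies inside, it can only be \<open>u\<close>. The same holds for
    \<open>v\<close> with the sides exchanged.\<close>
  with assms(5-8) have "u \<notin> pverts G2" "v \<notin> pverts G1"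
    by blast+
  \<comment> \<open>So \<open>u\<close> and \<open>v\<close> are outside \<open>pverts H\<close>,
    while the common vertices of \<open>I\<close> and \<open>J\<close> belong to both
    graphs.\<close>
  with \<open>I \<subseteq> insert u J\<close> \<open>J \<subseteq> insert v I\<close> assms(5,7)
  have "I \<inter> pverts H = I \<inter> J" "J \<inter> pverts H = I \<inter> J"
    unfolding H by blast+
  moreover have "card (I \<inter> J) = k - 1"
  proof -
    have "finite I"
      using assms(5) G1.pair_finite_verts finite_subset by blast
    moreover have "I \<inter> J = I - {u}" "u \<in> I"
      using uv by blast+
    moreover have "card I = k"
      using mem(1) by (simp add: independent_sets_def)
    ultimately show ?thesis
      by simp
  qed
  ultimately show ?thesis
    unfolding crossing_free_def using mem by metis
qed

theorem corollary13:
  fixes G1 G2 H :: "'a pair_pre_digraph" and k :: nat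
  assumes "k \<ge> 2"
    and "pair_graph G1" and "pair_graph G2"
    and "consistent H G1 G2"
  shows "crossing_free k H G1 G2 \<longleftrightarrow>
    with_proj (TS k (join H G1 G2)) =
      Digraph_Component.union (with_proj (TS k G1)) (with_proj (TS k G2))"
proof -
  let ?J = "join H G1 G2"
  note iffs = parcs_TS_iff_left[OF assms(3,4)] parcs_TS_iff_right[OF assms(2,4)]
  have "crossing_free k H G1 G2 \<longleftrightarrow> parcs (TS k ?J) = parcs (TS k G1) \<union> parcs (TS k G2)"
  proof
    assume cf: "crossing_free k H G1 G2"
    have arc: "(I, J) \<in> parcs (TS k G1) \<union> parcs (TS k G2)" if a: "(I, J) \<in> parcs (TS k ?J)" for I J
    proof (rule ccontr)
      assume n: "\<not> ?thesis"
      have side: "S \<subseteq> pverts G1 \<or> S \<subseteq> pverts G2" if "S = I \<or> S = J" for S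
        using a that independent_set_join_side[OF assms(4)]
        by (auto simp: TS_def independent_sets_def)
      interpret T: pair_graph "TS k ?J"
        by (intro pair_graph_TS pair_graph_join assms)
      \<comment> \<open>A crossing takes its first set from \<open>G1\<close>; the reversed arc
        serves the case where \<open>J\<close>, not \<open>I\<close>, lies on that side.\<close>
      have a': "(J, I) \<in> parcs (TS k ?J)"
        using a by (rule T.arcs_symmetric)
      have "\<not> (I \<subseteq> pverts G1 \<and> J \<subseteq> pverts G1)" "\<not> (I \<subseteq> pverts G2 \<and> J \<subseteq> pverts G2)"
        using n a iffs by simp_all
      then show False
        using side[of I] side[of J] TS_join_crossing[OF assms(2-4) a]
          TS_join_crossing[OF assms(2-4) a'] cf
        by metis
    qed
    show "parcs (TS k ?J) = parcs (TS k G1) \<union> parcs (TS k G2)"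
    proof (rule subset_antisym)
      show "parcs (TS k ?J) \<subseteq> parcs (TS k G1) \<union> parcs (TS k G2)"
        using arc by (rule subrelI)
      show "parcs (TS k G1) \<union> parcs (TS k G2) \<subseteq> parcs (TS k ?J)"
        by (rule subrelI) (auto simp only: iffs Un_iff)
    qed
  next
    assume eq: "parcs (TS k ?J) = parcs (TS k G1) \<union> parcs (TS k G2)"
    show "crossing_free k H G1 G2"
      unfolding crossing_free_def
    proof (intro notI, elim bexE conjE)
      fix I J
      assume "I \<in> independent_sets k G1" "J \<in> independent_sets k G2"
        "card (I \<inter> pverts H) = k - 1" "card (J \<inter> pverts H) = k - 1" "card (I \<inter> J) = k - 1"
      moreover have "k \<ge> 1"
        using assms(1) by simp
      ultimately have "(I, J) \<in> parcs (TS k ?J)" "\<not> J \<subseteq> pverts G1" "\<not> I \<subseteq> pverts G2"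
        using crossing_TS_join[OF assms(2-4)] by metis+
      \<comment> \<open>The arc lies in neither \<open>TS k G1\<close> nor \<open>TS k G2\<close>:
        \<open>J\<close> leaves the first side and \<open>I\<close> the second.\<close>
      then show False
        using eq iffs[of I J k] by (metis Un_iff)
    qed
  qed
  then show ?thesis
    using pverts_TS_join[OF assms(2-4)] by (simp add: with_proj_eq_union_iff)
qed

end
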